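(* Let $\nu>2$, $\tilde\nu>2$, $M\ge1$, let $K_{Z,Z'}$ and $\mathbf{S}$ be symmetric positive definite $M\times M$ matrices, let $\mathbf{m}\in\mathbb{R}^M$, and let $q(\mathbf{u})=\mathcal{ST}(\tilde\nu,\mathbf{m},\mathbf{S})$ on $\mathbb{R}^M$. Define $$\mathcal{L}_2=\mathbb{E}_{q(\mathbf{u})}\left\{\log\left[1+\frac{1}{\nu-2}\mathbf{u}^\top K_{Z,Z'}^{-1}\mathbf{u}\right]\right\}.$$ Then $$\mathcal{L}_2\le\log\left\{1+\frac{1}{\nu-2}\mathrm{Tr}\left(K_{Z,Z'}^{-1}\mathbf{S}\right)+\frac{1}{\nu-2}\mathrm{Tr}\left(K_{Z,Z'}^{-1}\mathbf{m}\mathbf{m}^\top\right)\right\}.$$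
   Context: For $\nu>2$, $\boldsymbol\mu\in\mathbb{R}^d$ and a symmetric positive definite $d\times d$ matrix $\mathbf{R}$, $\mathcal{ST}(\nu,\boldsymbol\mu,\mathbf{R})$ is the multivariate Student-t distribution on $\mathbb{R}^d$ with density $$\frac{\Gamma\left(\frac{\nu+d}{2}\right)|\mathbf{R}|^{-1/2}}{\Gamma\left(\frac\nu2\right)((\nu-2)\pi)^{d/2}}\left(1+\frac{(\mathbf{v}-\boldsymbol\mu)^\top\mathbf{R}^{-1}(\mathbf{v}-\boldsymbol\mu)}{\nu-2}\right)^{-\frac{\nu+d}{2}}.$$ Here $K_{Z,Z'}$ is the kernel matrix at $M$ inducing points, $\nu$ is the prior degrees of freedom and $q(\mathbf{u})$ is the variational distribution. *)

theory Defs
  imports "HOL-Probability.Probability"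
begin

definition sym_pos_def :: "real^'n^'n \<Rightarrow> bool" where
  "sym_pos_def A \<longleftrightarrow> transpose A = A \<and> (\<forall>x. x \<noteq> 0 \<longrightarrow> x \<bullet> (A *v x) > 0)"

(* The scaling by nu - 2 instead of the usual nu makes R the covariance matrix, not merely the
   scale matrix. Only meaningful for nu > 2 and symmetric positive definite R. *)
definition student_t_density :: "real \<Rightarrow> real^'n \<Rightarrow> real^'n^'n \<Rightarrow> real^'n \<Rightarrow> real" where
  "student_t_density nu \<mu> R v =
     Gamma ((nu + real CARD('n)) / 2) * det R powr (- 1 / 2)
       / (Gamma (nu / 2) * ((nu - 2) * pi) powr (real CARD('n) / 2))
     * (1 + ((v - \<mu>) \<bullet> (matrix_inv R *v (v - \<mu>))) / (nu - 2)) powr (- ((nu + real CARD('n)) / 2))"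

definition student_t :: "real \<Rightarrow> real^'n \<Rightarrow> real^'n^'n \<Rightarrow> (real^'n) measure" where
  "student_t nu \<mu> R = density lborel (\<lambda>v. ennreal (student_t_density nu \<mu> R v))"

definition log_quadratic :: "real \<Rightarrow> real^'n^'n \<Rightarrow> real^'n \<Rightarrow> real" where
  "log_quadratic nu K u = ln (1 + 1 / (nu - 2) * (u \<bullet> (matrix_inv K *v u)))"

definition L2 :: "real \<Rightarrow> real^'n^'n \<Rightarrow> (real^'n) measure \<Rightarrow> real" where
  "L2 nu K q = (\<integral>u. log_quadratic nu K u \<partial>q)"

(* The type constraints make the product of the column and the row an n x n outer product. *)
definition outer_product :: "real^'n \<Rightarrow> real^'n \<Rightarrow> real^'n^'n" where
  "outer_product x y = (columnvector x :: real^1^'n) ** (rowvector y :: real^'n^1)"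

end

(* A Student-t vector is an affine image m + B x of the standard one, where S = B B^T. The standard one
   is a Gamma mixture of Gaussians, since Gamma(p) (1 + Q)^(-p) is the integral of
   t^(p-1) exp(-t (1 + Q)) over t > 0; so Tonelli reduces its total mass and second moments to
   one-dimensional Gaussian integrals, and reflecting a coordinate kills its means and mixed moments. Thus
   E[u_i u_j] = S_ij + m_i m_j, which gives the mean of the quadratic form, and Jensen's inequality
   for the logarithm finishes the proof. *)
theory Submission
  imports Defs
begin

subsection \<open>Factorization of positive definite matrices\<close>

text \<open>The tails are polynomial, so the existence of second moments is itself something to
  prove. Total mass and squares are therefore computed as integrals of nonnegative functions with
  values in \<open>ennreal\<close>, where Tonelli asks for no integrability. Their finite values
  make the squares integrable, and the squares then dominate the signed functions
  \<open>x $ i\<close> and \<open>x $ i * x $ j\<close>. In the mixture the coordinates have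
  variance \<open>(nu - 2) / (2 * t)\<close> given t. Averaging over t turns
  \<open>Gamma (nu / 2)\<close> into \<open>Gamma (nu / 2 - 1)\<close>, which is where
  \<open>nu > 2\<close> enters; the recurrence of Gamma shows that the scaling by
  \<open>nu - 2\<close> makes the variance exactly 1. Passing from the standard law to a general one
  needs the change of variables for an arbitrary invertible matrix, which is assembled from
  elementary matrices.\<close>

lemma sym_pos_def_invertible:
  fixes A :: "real^'n^'n"
  assumes "sym_pos_def A"
  shows "invertible A"
proof -
  have "x = 0" if "A *v x = 0" for x
    using assms that unfolding sym_pos_def_def by (metis inner_zero_right less_irrefl)
  then show ?thesis
    by (meson invertible_left_inverse matrix_left_invertible_ker)
qed

lemma
  fixes A :: "real^'n^'n"
  assumes "invertible A"
  shows matrix_inv_right: "A ** matrix_inv A = mat 1"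
    and matrix_inv_left: "matrix_inv A ** A = mat 1"
  using someI_ex[OF assms[unfolded invertible_def]] unfolding matrix_inv_def by auto

text \<open>For square matrices a right inverse is also a left inverse, so a single product suffices
  to identify the inverse.\<close>

lemma matrix_inv_unique:
  fixes A B :: "real^'n^'n"
  assumes "A ** B = mat 1"
  shows "matrix_inv A = B"
proof -
  have "B ** A = mat 1" using assms matrix_left_right_inverse by blast
  then have "invertible A" using assms invertible_def by blast
  then have "matrix_inv A ** A = mat 1" by (simp add: matrix_inv_left)
  then show ?thesis by (metis assms matrix_mul_assoc matrix_mul_lid matrix_mul_rid)
qed

text \<open>Transposing the left inverse law shows that the transposed inverse is again an inverse
  of A. Positivity follows from the substitution x = A z, which turns the form of the inverse at x
  into the form of A at z.\<close>

lemma sym_pos_def_matrix_inv: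
  fixes A :: "real^'n^'n"
  assumes "sym_pos_def A"
  shows "sym_pos_def (matrix_inv A)"
proof -
  have inv: "A ** matrix_inv A = mat 1" "matrix_inv A ** A = mat 1"
    using sym_pos_def_invertible[OF assms] by (simp_all add: matrix_inv_left matrix_inv_right)
  have tA: "transpose A = A" using assms by (simp add: sym_pos_def_def)
  have "A ** transpose (matrix_inv A) = mat 1"
    using inv(2) by (metis matrix_transpose_mul tA transpose_mat)
  then have "transpose (matrix_inv A) = matrix_inv A"
    using matrix_inv_unique by metis
  moreover have "x \<bullet> (matrix_inv A *v x) > 0" if "x \<noteq> 0" for x
  proof -
    let ?z = "matrix_inv A *v x"
    have x: "A *v ?z = x" by (simp add: matrix_vector_mul_assoc inv)
    then have "?z \<noteq> 0" using that by (metis matrix_vector_mult_0_right)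
    then have "?z \<bullet> (A *v ?z) > 0" using assms by (simp add: sym_pos_def_def)
    then show ?thesis by (simp add: x inner_commute)
  qed
  ultimately show ?thesis by (simp add: sym_pos_def_def)
qed

(* Gram-Schmidt for the inner product given by A, applied to the coordinate axes in J. *)
lemma sym_pos_def_orthonormal_family:
  fixes A :: "real^'n^'n"
  assumes "sym_pos_def A"
  shows "\<exists>b :: 'n \<Rightarrow> real^'n. (\<forall>i\<in>J. \<forall>j\<in>J. b i \<bullet> (A *v b j) = (if i = j then 1 else 0))
           \<and> (\<forall>i\<in>J. \<forall>k. k \<notin> J \<longrightarrow> b i $ k = 0)"
  using finite[of J]
proof (induction J rule: finite_induct)
  case empty
  then show ?case by auto
next
  case (insert j J)
  then obtain b :: "'n \<Rightarrow> real^'n"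
    where b: "\<And>i k. i \<in> J \<Longrightarrow> k \<in> J \<Longrightarrow> b i \<bullet> (A *v b k) = (if i = k then 1 else 0)"
      and b0: "\<And>i k. i \<in> J \<Longrightarrow> k \<notin> J \<Longrightarrow> b i $ k = 0" by blast
  have sym: "x \<bullet> (A *v y) = y \<bullet> (A *v x)" for x y
    using assms unfolding sym_pos_def_def
    by (metis dot_lmul_matrix inner_commute transpose_matrix_vector)
  define e where "e = (axis j 1 :: real^'n)"
  \<comment> \<open>Residual of \<open>e\<close> after subtracting its A-orthogonal projection onto
    the vectors already built.\<close>
  define w where "w = e - (\<Sum>i\<in>J. (b i \<bullet> (A *v e)) *\<^sub>R b i)"
  \<comment> \<open>The earlier vectors vanish at coordinate j by the support condition in the
    statement, so the entry of \<open>e\<close> survives. This makes \<open>w\<close> nonzero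
    without a separate argument about linear independence.\<close>
  have wj: "w $ j = 1" using b0 insert.hyps by (simp add: w_def e_def)
  have w0: "w $ k = 0" if "k \<notin> insert j J" for k
    using b0 that by (simp add: w_def e_def axis_def)
  have orth: "b k \<bullet> (A *v w) = 0" if "k \<in> J" for k
  proof -
    have "(\<Sum>i\<in>J. b i \<bullet> (A *v e) * (b k \<bullet> (A *v b i))) = (\<Sum>i\<in>J. if i = k then b i \<bullet> (A *v e) else 0)"
      using b that by (intro sum.cong) auto
    then show ?thesis using that insert.hyps
      by (simp add: w_def matrix_vector_mult_diff_distrib inner_diff_right
            linear_sum[OF matrix_vector_mul_linear] inner_sum_right matrix_vector_mult_scaleR)
  qed
  define q where "q = w \<bullet> (A *v w)"
  have "w \<noteq> 0" using wj by auto
  then have q: "q > 0" using assms by (simp add: q_def sym_pos_def_def)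
  define c where "c = (b(j := (1 / sqrt q) *\<^sub>R w))"
  have "c i \<bullet> (A *v c k) = (if i = k then 1 else 0)" if "i \<in> insert j J" "k \<in> insert j J" for i k
  proof (cases "i = j")
    case True
    then show ?thesis using that q orth[of k] sym[of w "b k"] insert.hyps q_def[symmetric]
      by (auto simp: c_def matrix_vector_mult_scaleR)
  next
    case False
    then show ?thesis using that q b[of i k] orth[of i] insert.hyps
      by (auto simp: c_def matrix_vector_mult_scaleR)
  qed
  moreover have "c i $ k = 0" if "i \<in> insert j J" "k \<notin> insert j J" for i k
    using that b0 w0 by (auto simp: c_def)
  ultimately show ?case by blast
qed

text \<open>Gram-Schmidt is run for the inverse of S rather than for S: if the columns of B are
  orthonormal for it, then the transpose of B times the inverse of S times B is the identity, and
  solving for S gives the product of B and its transpose.\<close>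

lemma sym_pos_def_factorization:
  fixes S :: "real^'n^'n"
  assumes "sym_pos_def S"
  obtains B :: "real^'n^'n" where "B ** transpose B = S" "invertible B"
proof -
  let ?A = "matrix_inv S"
  obtain b :: "'n \<Rightarrow> real^'n" where b: "\<And>i j. b i \<bullet> (?A *v b j) = (if i = j then 1 else 0)"
    using sym_pos_def_orthonormal_family[OF sym_pos_def_matrix_inv[OF assms], of UNIV] by blast
  define B :: "real^'n^'n" where "B = (\<chi> i j. b j $ i)"
  have "(transpose B ** (?A ** B)) $ i $ j = b i \<bullet> (?A *v b j)" for i j
    by (simp add: B_def matrix_matrix_mult_def transpose_def inner_vec_def matrix_vector_mult_def)
  then have "transpose B ** (?A ** B) = mat 1" by (simp add: vec_eq_iff b mat_def)
  then have 1: "?A ** B ** transpose B = mat 1" using matrix_left_right_inverse by blast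
  then have "B ** transpose B = S"
    by (metis assms matrix_inv_right matrix_mul_assoc matrix_mul_lid matrix_mul_rid sym_pos_def_invertible)
  moreover have "invertible B"
    using \<open>transpose B ** (?A ** B) = mat 1\<close> by (metis invertible_left_inverse matrix_mul_assoc)
  ultimately show ?thesis using that by blast
qed

subsection \<open>Linear change of variables\<close>

lemma nn_integral_lborel_translation:
  fixes a :: "'a::euclidean_space"
  assumes [measurable]: "f \<in> borel_measurable borel"
  shows "(\<integral>\<^sup>+x. f (x + a) \<partial>lborel) = (\<integral>\<^sup>+x. f x \<partial>lborel)"
proof -
  have "(\<integral>\<^sup>+x. f x \<partial>lborel) = (\<integral>\<^sup>+x. f x \<partial>distr lborel borel ((+) a))"
    by (simp add: lborel_distr_plus)
  also have "\<dots> = (\<integral>\<^sup>+x. f (a + x) \<partial>lborel)" by (rule nn_integral_distr) auto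
  finally show ?thesis by (simp add: add.commute)
qed

(* The weight \<open>indicator {0<..<1} (x \<bullet> e + t)\<close> has \<open>t\<close>-integral 1; inserting it turns the shear into a
   translation of the auxiliary variable t for each fixed x. *)
lemma nn_integral_lborel_shear:
  fixes e :: "'a::euclidean_space" and c :: "'a \<Rightarrow> real"
  assumes [measurable]: "f \<in> borel_measurable borel" "c \<in> borel_measurable borel"
    and e: "e \<in> Basis" and c: "\<And>x t. c (x + t *\<^sub>R e) = c x"
  shows "(\<integral>\<^sup>+x. f (x + c x *\<^sub>R e) \<partial>lborel) = (\<integral>\<^sup>+x. f x \<partial>lborel)"
proof -
  let ?g = "\<lambda>s::real. indicator {0<..<1} s :: ennreal"
  have g: "(\<integral>\<^sup>+t. ?g (s + t) \<partial>lborel) = 1" for s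
    using nn_integral_lborel_translation[of ?g s] by (simp add: add.commute)
  have e1: "e \<bullet> e = 1" using e by (simp add: inner_Basis)
  have weighted: "(\<integral>\<^sup>+x. f (x + d x *\<^sub>R e) \<partial>lborel)
      = (\<integral>\<^sup>+x. (\<integral>\<^sup>+t. f (x - t *\<^sub>R e) \<partial>lborel) * ?g (x \<bullet> e) \<partial>lborel)"
    if [measurable]: "d \<in> borel_measurable borel" and d: "\<And>x t. d (x + t *\<^sub>R e) = d x" for d
  proof -
    have "(\<integral>\<^sup>+x. f (x + d x *\<^sub>R e) \<partial>lborel) = (\<integral>\<^sup>+x. \<integral>\<^sup>+t. f (x + d x *\<^sub>R e) * ?g (x \<bullet> e + t) \<partial>lborel \<partial>lborel)"
      by (simp add: nn_integral_cmult g)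
    also have "\<dots> = (\<integral>\<^sup>+t. \<integral>\<^sup>+x. f (x + d x *\<^sub>R e) * ?g (x \<bullet> e + t) \<partial>lborel \<partial>lborel)"
      by (rule lborel_pair.Fubini'[symmetric]) measurable
    also have "\<dots> = (\<integral>\<^sup>+t. \<integral>\<^sup>+x. f (x - t *\<^sub>R e + d x *\<^sub>R e) * ?g (x \<bullet> e) \<partial>lborel \<partial>lborel)"
    proof (rule nn_integral_cong)
      fix t :: real
      \<comment> \<open>Translating x by \<open>- t *\<^sub>R e\<close> removes t from the weight
        and leaves \<open>d\<close> alone, because \<open>d\<close> is constant along
        \<open>e\<close>.\<close>
      have "d (x - t *\<^sub>R e) = d x" for x using d[of x "- t"] by simp
      then show "(\<integral>\<^sup>+x. f (x + d x *\<^sub>R e) * ?g (x \<bullet> e + t) \<partial>lborel)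
          = (\<integral>\<^sup>+x. f (x - t *\<^sub>R e + d x *\<^sub>R e) * ?g (x \<bullet> e) \<partial>lborel)"
        using nn_integral_lborel_translation[of "\<lambda>x. f (x + d x *\<^sub>R e) * ?g (x \<bullet> e + t)" "- t *\<^sub>R e"]
        by (simp add: inner_diff_left e1)
    qed
    also have "\<dots> = (\<integral>\<^sup>+x. \<integral>\<^sup>+t. f (x - t *\<^sub>R e + d x *\<^sub>R e) * ?g (x \<bullet> e) \<partial>lborel \<partial>lborel)"
      by (rule lborel_pair.Fubini') measurable
    also have "\<dots> = (\<integral>\<^sup>+x. (\<integral>\<^sup>+t. f (x - t *\<^sub>R e) \<partial>lborel) * ?g (x \<bullet> e) \<partial>lborel)"
    proof (rule nn_integral_cong)
      fix x :: 'a
      \<comment> \<open>For fixed x the shear is now a translation of t by the constant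
        \<open>d x\<close>, and the weight no longer contains t.\<close>
      have "(\<integral>\<^sup>+t. f (x - t *\<^sub>R e + d x *\<^sub>R e) \<partial>lborel) = (\<integral>\<^sup>+t. f (x - t *\<^sub>R e) \<partial>lborel)"
        using nn_integral_lborel_translation[of "\<lambda>t. f (x - t *\<^sub>R e)" "- d x"]
        by (simp add: algebra_simps)
      then show "(\<integral>\<^sup>+t. f (x - t *\<^sub>R e + d x *\<^sub>R e) * ?g (x \<bullet> e) \<partial>lborel)
          = (\<integral>\<^sup>+t. f (x - t *\<^sub>R e) \<partial>lborel) * ?g (x \<bullet> e)"
        by (simp add: nn_integral_multc)
    qed
    finally show ?thesis .
  qed
  \<comment> \<open>The right-hand side of \<open>weighted\<close> does not mention
    \<open>d\<close>, so the choices \<open>d = 0\<close> and \<open>d = c\<close> give equal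
    integrals.\<close>
  have "(\<integral>\<^sup>+x. f (x + 0 *\<^sub>R e) \<partial>lborel)
      = (\<integral>\<^sup>+x. (\<integral>\<^sup>+t. f (x - t *\<^sub>R e) \<partial>lborel) * ?g (x \<bullet> e) \<partial>lborel)"
    by (rule weighted) auto
  with weighted[OF assms(2) c] show ?thesis by (simp only: scaleR_zero_left add_0_right)
qed

lemma borel_measurable_affine_matrix [measurable]:
  fixes B :: "real^'n^'m"
  shows "(\<lambda>x. m + B *v x) \<in> borel_measurable borel" "(\<lambda>x. B *v x) \<in> borel_measurable borel"
  by (intro borel_measurable_continuous_onI continuous_intros)+

(* The linear change of variables in \<open>Change_Of_Vars\<close> is restricted to well-ordered index types. *)
lemma nn_integral_lborel_matrix:
  fixes B :: "real^'n^'n"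
  assumes "invertible B" and "f \<in> borel_measurable borel"
  shows "ennreal \<bar>det B\<bar> * (\<integral>\<^sup>+x. f (B *v x) \<partial>lborel) = (\<integral>\<^sup>+x. f x \<partial>lborel)"
proof -
  \<comment> \<open>The property is multiplicative, so it can be checked on elementary factors. Its
    invertibility premise makes the case of a zero row vacuous and passes from a product to both
    factors through the determinant.\<close>
  let ?P = "\<lambda>B::real^'n^'n. invertible B \<longrightarrow> (\<forall>f\<in>borel_measurable borel.
    ennreal \<bar>det B\<bar> * (\<integral>\<^sup>+x. f (B *v x) \<partial>lborel) = (\<integral>\<^sup>+x. f x \<partial>lborel))"
  have "?P B"
  proof (rule induct_matrix_elementary_alt)
    fix A B :: "real^'n^'n"
    assume A: "?P A" and B: "?P B"
    show "?P (A ** B)"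
    proof (intro impI ballI)
      fix f :: "real^'n \<Rightarrow> ennreal"
      assume "invertible (A ** B)" and [measurable]: "f \<in> borel_measurable borel"
      then have inv: "invertible A" "invertible B" by (auto simp: invertible_det_nz det_mul)
      have "ennreal \<bar>det (A ** B)\<bar> * (\<integral>\<^sup>+x. f ((A ** B) *v x) \<partial>lborel)
          = ennreal \<bar>det A\<bar> * (ennreal \<bar>det B\<bar> * (\<integral>\<^sup>+x. f (A *v (B *v x)) \<partial>lborel))"
        by (simp add: det_mul abs_mult ennreal_mult mult.assoc matrix_vector_mul_assoc)
      also have "\<dots> = ennreal \<bar>det A\<bar> * (\<integral>\<^sup>+x. f (A *v x) \<partial>lborel)"
        by (subst B[rule_format, OF inv(2), of "\<lambda>x. f (A *v x)"]) auto
      also have "\<dots> = (\<integral>\<^sup>+x. f x \<partial>lborel)" by (rule A[rule_format, OF inv(1)]) auto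
      finally show "ennreal \<bar>det (A ** B)\<bar> * (\<integral>\<^sup>+x. f ((A ** B) *v x) \<partial>lborel) = (\<integral>\<^sup>+x. f x \<partial>lborel)" .
    qed
  next
    fix A :: "real^'n^'n" and i
    assume "row i A = 0"
    then show "?P A" by (simp add: invertible_det_nz det_zero_row)
  next
    fix A :: "real^'n^'n"
    assume diag: "\<And>i j. i \<noteq> j \<Longrightarrow> A $ i $ j = 0"
    show "?P A"
    proof (intro impI ballI)
      fix f :: "real^'n \<Rightarrow> ennreal"
      assume "invertible A" and [measurable]: "f \<in> borel_measurable borel"
      then have nz: "A $ i $ i \<noteq> 0" for i
        using diag by (simp add: invertible_det_nz det_diagonal)
      \<comment> \<open>The library rule for diagonal scalings takes its factors as a function on
        \<open>Basis\<close>; this linear functional sends the i-th axis to the i-th diagonal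
        entry.\<close>
      define c where "c b = (\<Sum>i\<in>UNIV. A $ i $ i * b $ i)" for b :: "real^'n"
      have c: "c (axis i 1) = A $ i $ i" for i
        by (simp add: c_def axis_def if_distrib[of "\<lambda>a. _ * a"] cong: if_cong)
      have B: "(Basis :: (real^'n) set) = range (\<lambda>i. axis i 1)" by (auto simp: Basis_vec_def)
      have inj: "inj (\<lambda>i::'n. axis i (1::real))" by (auto simp: inj_on_def axis_eq_axis)
      have cnz: "c j \<noteq> 0" if "j \<in> Basis" for j using that nz by (auto simp: B c)
      have T: "0 + (\<Sum>j\<in>Basis. (c j * (x \<bullet> j)) *\<^sub>R j) = A *v x" for x :: "real^'n"
      proof -
        have "(A *v x) $ i = A $ i $ i * x $ i" for i
          using diag by (simp add: matrix_vector_mult_def) (subst sum.remove[of _ i], auto)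
        moreover have "(\<Sum>j\<in>Basis. (c j * (x \<bullet> j)) *\<^sub>R j) $ i = A $ i $ i * x $ i" for i
          by (simp add: B sum.reindex[OF inj] c inner_axis)
             (simp add: axis_def if_distrib[of "\<lambda>a. _ * a"] cong: if_cong)
        ultimately show ?thesis by (simp add: vec_eq_iff)
      qed
      have d: "(\<Prod>j\<in>(Basis :: (real^'n) set). \<bar>c j\<bar>) = \<bar>det A\<bar>"
        using diag by (simp add: B prod.reindex[OF inj] c det_diagonal abs_prod)
      have "lborel = density (distr lborel borel (\<lambda>x. A *v x)) (\<lambda>_. ennreal \<bar>det A\<bar>)"
        using lborel_affine_euclidean[of c 0, OF cnz] unfolding T d .
      then have "(\<integral>\<^sup>+x. f x \<partial>lborel) = (\<integral>\<^sup>+x. f x \<partial>density (distr lborel borel (\<lambda>x. A *v x)) (\<lambda>_. ennreal \<bar>det A\<bar>))"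
        by (rule arg_cong[where f = "\<lambda>M. nn_integral M f"])
      also have "\<dots> = (\<integral>\<^sup>+x. ennreal \<bar>det A\<bar> * f x \<partial>distr lborel borel (\<lambda>x. A *v x))"
        by (rule nn_integral_density) measurable
      also have "\<dots> = (\<integral>\<^sup>+x. ennreal \<bar>det A\<bar> * f (A *v x) \<partial>lborel)"
        by (rule nn_integral_distr) measurable
      also have "\<dots> = ennreal \<bar>det A\<bar> * (\<integral>\<^sup>+x. f (A *v x) \<partial>lborel)"
        by (rule nn_integral_cmult) measurable
      finally show "ennreal \<bar>det A\<bar> * (\<integral>\<^sup>+x. f (A *v x) \<partial>lborel) = (\<integral>\<^sup>+x. f x \<partial>lborel)"
        by (rule sym)
    qed
  next
    fix m n :: 'n
    assume "m \<noteq> n"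
    let ?\<tau> = "Transposition.transpose m n"
    let ?A = "(\<chi> i j. mat 1 $ i $ ?\<tau> j) :: real^'n^'n"
    have A: "?A *v x = (\<chi> i. x $ ?\<tau> i)" for x
    proof -
      have "(?A *v x) $ i = (\<Sum>j\<in>UNIV. if j = ?\<tau> i then x $ j else 0)" for i
        unfolding matrix_vector_mult_def vec_lambda_beta
        by (intro sum.cong) (auto simp: mat_def)
      then show ?thesis by (simp add: vec_eq_iff)
    qed
    have d: "\<bar>det ?A\<bar> = 1"
      by (simp add: det_permute_columns permutes_swap_id sign_swap_id abs_mult \<open>m \<noteq> n\<close>)
    \<comment> \<open>Lebesgue measure is determined by its values on boxes, and swapping two
      coordinates maps a box to a box with the same side lengths in another order.\<close>
    have "lborel = distr lborel borel (\<lambda>x. ?A *v x)"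
    proof (rule lborel_eqI)
      fix l u :: "real^'n"
      assume lu: "\<And>b. b \<in> Basis \<Longrightarrow> l \<bullet> b \<le> u \<bullet> b"
      let ?s = "\<lambda>x::real^'n. \<chi> i. x $ ?\<tau> i"
      have le: "l $ i \<le> u $ i" for i using lu[of "axis i 1"] by (simp add: inner_axis)
      have "(\<lambda>x. ?A *v x) -` box l u = box (?s l) (?s u)"
        by (auto simp: A mem_box_cart) (metis transpose_involutory)+
      then have "emeasure (distr lborel borel (\<lambda>x. ?A *v x)) (box l u) = emeasure lborel (box (?s l) (?s u))"
        by (simp add: emeasure_distr)
      also have "\<dots> = ennreal (\<Prod>b\<in>Basis. (?s u - ?s l) \<bullet> b)"
        using le by (intro emeasure_lborel_box) (auto simp: Basis_vec_def inner_axis)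
      also have "(\<Prod>b\<in>Basis. (?s u - ?s l) \<bullet> b) = (\<Prod>i\<in>UNIV. (u - l) $ ?\<tau> i)"
        by (subst prod.reindex_bij_betw[of "\<lambda>i. axis i 1" UNIV Basis, symmetric])
           (auto simp: bij_betw_def inj_on_def axis_eq_axis Basis_vec_def inner_axis)
      also have "\<dots> = (\<Prod>i\<in>UNIV. (u - l) $ i)"
        using prod.permute[OF permutes_swap_id[of m UNIV n], of "\<lambda>i. (u - l) $ i"] by (simp add: o_def)
      also have "\<dots> = (\<Prod>b\<in>Basis. (u - l) \<bullet> b)"
        by (subst prod.reindex_bij_betw[of "\<lambda>i. axis i 1" UNIV Basis, symmetric])
           (auto simp: bij_betw_def inj_on_def axis_eq_axis Basis_vec_def inner_axis)
      finally show "emeasure (distr lborel borel (\<lambda>x. ?A *v x)) (box l u) = (\<Prod>b\<in>Basis. (u - l) \<bullet> b)" .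
    qed simp
    then have "(\<integral>\<^sup>+x. f x \<partial>lborel) = (\<integral>\<^sup>+x. f x \<partial>distr lborel borel (\<lambda>x. ?A *v x))"
      for f :: "real^'n \<Rightarrow> ennreal"
      by (rule arg_cong[where f = "\<lambda>M. nn_integral M f"])
    moreover have "(\<integral>\<^sup>+x. f x \<partial>distr lborel borel (\<lambda>x. ?A *v x)) = (\<integral>\<^sup>+x. f (?A *v x) \<partial>lborel)"
      if "f \<in> borel_measurable borel" for f :: "real^'n \<Rightarrow> ennreal"
      by (rule nn_integral_distr) (use that in auto)
    ultimately have eq: "(\<integral>\<^sup>+x. f (?A *v x) \<partial>lborel) = (\<integral>\<^sup>+x. f x \<partial>lborel)"
      if "f \<in> borel_measurable borel" for f :: "real^'n \<Rightarrow> ennreal"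
      using that by metis
    show "?P ?A" by (intro impI ballI) (simp only: d abs_one ennreal_1 mult_1 eq)
  next
    fix m n :: 'n
    assume mn: "m \<noteq> n"
    let ?A = "(\<chi> i j. of_bool (i = m \<and> j = n \<or> i = j)) :: real^'n^'n"
    \<comment> \<open>This matrix shears along axis m by the amount \<open>x $ n\<close>, which does
      not change along that axis because m and n differ.\<close>
    have A: "?A *v x = x + x $ n *\<^sub>R axis m 1" for x
    proof -
      have "(?A *v x) $ i = (\<Sum>j\<in>UNIV. (if j = i then x $ i else 0) + (if j = n then (if i = m then x $ n else 0) else 0))" for i
        unfolding matrix_vector_mult_def vec_lambda_beta using mn by (intro sum.cong) auto
      then show ?thesis by (simp add: vec_eq_iff sum.distrib axis_def)
    qed
    have "?A = (\<chi> k. if k = m then row m (mat 1) + 1 *s row n (mat 1) else row k (mat 1))"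
      using mn by (auto simp: vec_eq_iff row_def mat_def)
    then have d: "det ?A = 1" by (simp only: det_row_operation[OF mn] det_I)
    have eq: "(\<integral>\<^sup>+x. f (?A *v x) \<partial>lborel) = (\<integral>\<^sup>+x. f x \<partial>lborel)"
      if "f \<in> borel_measurable borel" for f :: "real^'n \<Rightarrow> ennreal"
      unfolding A
    proof (rule nn_integral_lborel_shear[OF that])
      show "(\<lambda>x::real^'n. x $ n) \<in> borel_measurable borel"
        by (intro borel_measurable_continuous_onI continuous_intros)
      show "axis m 1 \<in> (Basis :: (real^'n) set)" by simp
      show "(x + t *\<^sub>R axis m 1) $ n = x $ n" for x :: "real^'n" and t
        using mn by (simp add: axis_def)
    qed
    show "?P ?A" by (intro impI ballI) (simp only: d abs_one ennreal_1 mult_1 eq)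
  qed
  then show ?thesis using assms by blast
qed

text \<open>The change of variables is stated as an equation of measures so that it can be
  substituted for \<open>lborel\<close> inside the definition of \<open>student_t\<close>. It is
  tested on indicator functions.\<close>

lemma lborel_affine_matrix:
  fixes B :: "real^'n^'n" and m :: "real^'n"
  assumes "invertible B"
  shows "lborel = density (distr lborel borel (\<lambda>x. m + B *v x)) (\<lambda>_. ennreal \<bar>det B\<bar>)" (is "_ = ?D")
proof (rule measure_eqI)
  fix X :: "(real^'n) set"
  assume "X \<in> sets lborel"
  then have [measurable]: "X \<in> sets borel" by simp
  have "emeasure ?D X = (\<integral>\<^sup>+x. indicator X x \<partial>?D)" by simp
  also have "\<dots> = ennreal \<bar>det B\<bar> * (\<integral>\<^sup>+x. indicator X (m + B *v x) \<partial>lborel)"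
    by (simp add: nn_integral_density nn_integral_distr nn_integral_cmult del: nn_integral_indicator)
  also have "\<dots> = (\<integral>\<^sup>+x. indicator X (m + x) \<partial>lborel)"
    by (intro nn_integral_lborel_matrix assms) auto
  also have "\<dots> = emeasure lborel X"
    using nn_integral_lborel_translation[of "indicator X" m] by (simp add: add.commute)
  finally show "emeasure lborel X = emeasure ?D X" by simp
qed simp

subsection \<open>Gaussian and Gamma integrals\<close>

lemma borel_measurable_vec_nth [measurable (raw)]:
  "f \<in> borel_measurable M \<Longrightarrow> (\<lambda>x. f x $ i :: real) \<in> borel_measurable M"
  by (rule measurable_compose[of f M borel "\<lambda>v. v $ i"])
     (auto intro!: borel_measurable_continuous_onI continuous_intros)

lemma nn_integral_gaussian_moment:
  fixes s :: real
  assumes s: "s > 0"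
  shows "(\<integral>\<^sup>+x. ennreal (x ^ (2 * k) * exp (- s * x\<^sup>2)) \<partial>lborel)
           = ennreal (sqrt (pi / s) * (fact (2 * k) / ((4 * s) ^ k * fact k)))"
proof -
  \<comment> \<open>With variance \<open>1 / (2 * s)\<close> the function
    \<open>exp (- s * x\<^sup>2)\<close> is \<open>sqrt (pi / s)\<close> times the centred normal
    density, whose even moments are known.\<close>
  define \<sigma> where "\<sigma> = 1 / sqrt (2 * s)"
  have \<sigma>: "\<sigma> > 0" "\<sigma>\<^sup>2 = 1 / (2 * s)" using s by (auto simp: \<sigma>_def power_divide)
  have d: "x ^ (2 * k) * exp (- s * x\<^sup>2) = sqrt (pi / s) * (normal_density 0 \<sigma> x * (x - 0) ^ (2 * k))" for x
    using s by (simp add: normal_density_def \<sigma>(2) mult.commute)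
  have "has_bochner_integral lborel (\<lambda>x. x ^ (2 * k) * exp (- s * x\<^sup>2))
      (sqrt (pi / s) * (fact (2 * k) / ((2 / \<sigma>\<^sup>2)^k * fact k)))"
    unfolding d by (intro has_bochner_integral_mult_right normal_moment_even \<sigma>)
  then have *: "has_bochner_integral lborel (\<lambda>x. x ^ (2 * k) * exp (- s * x\<^sup>2))
      (sqrt (pi / s) * (fact (2 * k) / ((4 * s)^k * fact k)))"
    by (simp add: \<sigma>(2))
  then show ?thesis
    by (subst nn_integral_eq_integral)
       (auto simp: has_bochner_integral_iff power_mult)
qed

lemma nn_integral_gaussian_moment_vec:
  fixes s :: real and i :: "'n::finite"
  assumes s: "s > 0"
  shows "(\<integral>\<^sup>+x. ennreal ((x $ i) ^ (2 * k) * exp (- s * (x \<bullet> x))) \<partial>(lborel :: (real^'n) measure))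
           = ennreal ((pi / s) powr (CARD('n) / 2) * (fact (2 * k) / ((4 * s) ^ k * fact k)))"
proof -
  \<comment> \<open>The integrand is a product over coordinates: only coordinate i carries the
    power, and the others are the case k = 0 of the one-dimensional formula.\<close>
  define f where "f b y = ennreal ((if b = axis i 1 then y ^ (2 * k) else 1) * exp (- s * y\<^sup>2))"
    for b :: "real^'n" and y :: real
  have ai: "axis i 1 \<in> (Basis :: (real^'n) set)" by simp
  have "ennreal ((x $ i) ^ (2 * k) * exp (- s * (x \<bullet> x))) = (\<Prod>b\<in>Basis. f b (x \<bullet> b))" for x
  proof -
    have "(\<Prod>b\<in>Basis. f b (x \<bullet> b))
        = ennreal (\<Prod>b\<in>Basis. (if b = axis i 1 then (x \<bullet> b) ^ (2 * k) else 1) * exp (- s * (x \<bullet> b)\<^sup>2))"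
      unfolding f_def by (intro prod_ennreal) (auto simp: power_mult)
    also have "(\<Prod>b\<in>Basis. (if b = axis i 1 then (x \<bullet> b) ^ (2 * k) else 1) * exp (- s * (x \<bullet> b)\<^sup>2))
        = (x $ i) ^ (2 * k) * exp (- s * (x \<bullet> x))"
      using ai by (simp add: prod.distrib prod.delta exp_sum[symmetric] inner_axis
            euclidean_inner[of x x] power2_eq_square sum_distrib_left[symmetric] sum_negf)
    finally show ?thesis by simp
  qed
  then have "(\<integral>\<^sup>+x. ennreal ((x $ i) ^ (2 * k) * exp (- s * (x \<bullet> x))) \<partial>(lborel :: (real^'n) measure))
     = (\<integral>\<^sup>+x. (\<Prod>b\<in>Basis. f b (x \<bullet> b)) \<partial>lborel)" by simp
  also have "\<dots> = (\<Prod>b\<in>Basis. (\<integral>\<^sup>+y. f b y \<partial>lborel))"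
    by (rule nn_integral_lborel_prod) (auto simp: f_def)
  also have "\<dots> = (\<Prod>b\<in>Basis. ennreal (sqrt (pi / s) *
       (if b = (axis i 1 :: real^'n) then fact (2 * k) / ((4 * s) ^ k * fact k) else 1)))"
    using nn_integral_gaussian_moment[OF s, of k] nn_integral_gaussian_moment[OF s, of 0]
    by (intro prod.cong) (auto simp: f_def)
  also have "\<dots> = ennreal (\<Prod>b\<in>Basis. sqrt (pi / s) *
       (if b = (axis i 1 :: real^'n) then fact (2 * k) / ((4 * s) ^ k * fact k) else 1))"
    using s by (intro prod_ennreal) auto
  also have "(\<Prod>b\<in>Basis. sqrt (pi / s) *
       (if b = (axis i 1 :: real^'n) then fact (2 * k) / ((4 * s) ^ k * fact k) else 1))
     = sqrt (pi / s) ^ CARD('n) * (fact (2 * k) / ((4 * s) ^ k * fact k))"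
    using ai by (simp add: prod.distrib prod.delta)
  also have "sqrt (pi / s) ^ CARD('n) = (pi / s) powr (CARD('n) / 2)"
    using s by (simp add: powr_half_sqrt[symmetric] powr_powr powr_realpow[symmetric])
  finally show ?thesis .
qed

text \<open>Substituting a t for t in the Euler integral produces the factor a from the measure and
  \<open>a powr (p - 1)\<close> from the integrand.\<close>

lemma nn_integral_Gamma_scale:
  fixes p a :: real
  assumes "p > 0" "a > 0"
  shows "(\<integral>\<^sup>+t. ennreal (indicator {0..} t * (t powr (p - 1) * exp (- a * t))) \<partial>lborel)
           = ennreal (Gamma p * a powr (- p))"
proof -
  let ?I = "\<integral>\<^sup>+t. ennreal (indicator {0..} t * (t powr (p - 1) * exp (- a * t))) \<partial>lborel"
  have "ennreal (Gamma p) = (\<integral>\<^sup>+t. ennreal (indicator {0..} t * t powr (p - 1) / exp t) \<partial>lborel)"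
    using assms by (rule_tac Gamma_conv_nn_integral_real)
  also have "\<dots> = ennreal \<bar>a\<bar> * (\<integral>\<^sup>+t. ennreal (indicator {0..} (0 + a * t) * (0 + a * t) powr (p - 1) / exp (0 + a * t)) \<partial>lborel)"
    using assms by (intro nn_integral_real_affine) auto
  also have "(\<integral>\<^sup>+t. ennreal (indicator {0..} (0 + a * t) * (0 + a * t) powr (p - 1) / exp (0 + a * t)) \<partial>lborel)
      = (\<integral>\<^sup>+t. ennreal (a powr (p - 1)) * ennreal (indicator {0..} t * (t powr (p - 1) * exp (- a * t))) \<partial>lborel)"
    using assms by (intro nn_integral_cong)
      (auto simp: indicator_def ennreal_mult[symmetric] powr_mult exp_minus field_simps zero_le_mult_iff)
  also have "\<dots> = ennreal (a powr (p - 1)) * ?I"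
    by (rule nn_integral_cmult) auto
  finally have "ennreal (Gamma p) = ennreal (a * a powr (p - 1)) * ?I"
    using assms by (simp add: ennreal_mult mult.assoc)
  also have "a * a powr (p - 1) = a powr p" using assms by (simp add: powr_diff)
  finally have "ennreal (a powr (- p)) * ennreal (Gamma p) = ennreal (a powr (- p) * a powr p) * ?I"
    by (simp add: ennreal_mult mult.assoc)
  then show ?thesis using assms
    by (simp add: powr_minus ennreal_mult[symmetric] mult.commute Gamma_real_nonneg)
qed

text \<open>For fixed t > 0 the Gaussian in x has rate t / c, and its moment of order 2k contributes
  the power -n/2 - k of t, with n the dimension. What remains is an Euler integral with parameter p
  - n/2 - k, and the hypothesis on p is its condition of convergence.\<close>

lemma nn_integral_student_t_moment:
  fixes c p :: real and i :: "'n::finite"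
  assumes c: "c > 0" and p: "p > CARD('n) / 2 + k"
  shows "(\<integral>\<^sup>+x. ennreal ((x $ i) ^ (2 * k) * (1 + (x \<bullet> x) / c) powr (- p)) \<partial>(lborel :: (real^'n) measure))
    = ennreal ((c * pi) powr (CARD('n) / 2) * (c / 4) ^ k * (fact (2 * k) / fact k)
        * Gamma (p - CARD('n) / 2 - k) / Gamma p)"
proof -
  have p0: "p > 0" using p by (smt (verit) divide_nonneg_nonneg of_nat_0_le_iff)
  then have G: "Gamma p > 0" by (rule Gamma_real_pos)
  let ?n = "real CARD('n)"
  let ?C = "fact (2 * k) / fact k :: real"
  let ?F = "\<lambda>t (x::real^'n). ennreal (indicator {0..} t * (t powr (p - 1) * exp (- t))
        * ((x $ i) ^ (2 * k) * exp (- (t / c) * (x \<bullet> x))))"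
  have inner: "(\<integral>\<^sup>+t. ?F t x \<partial>lborel) = ennreal (Gamma p) * ennreal ((x $ i) ^ (2 * k) * (1 + (x \<bullet> x) / c) powr (- p))"
    for x :: "real^'n"
  proof -
    have a: "1 + (x \<bullet> x) / c > 0" using c by (simp add: add_pos_nonneg)
    have "(\<integral>\<^sup>+t. ?F t x \<partial>lborel) = (\<integral>\<^sup>+t. ennreal ((x $ i) ^ (2 * k)) *
       ennreal (indicator {0..} t * (t powr (p - 1) * exp (- (1 + (x \<bullet> x) / c) * t))) \<partial>lborel)"
      by (intro nn_integral_cong)
         (auto simp: ennreal_mult[symmetric] power_mult indicator_def exp_add[symmetric] algebra_simps
           exp_minus exp_diff divide_inverse)
    also have "\<dots> = ennreal ((x $ i) ^ (2 * k)) * ennreal (Gamma p * (1 + (x \<bullet> x) / c) powr (- p))"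
      by (subst nn_integral_cmult) (measurable, simp only: nn_integral_Gamma_scale[OF p0 a])
    finally show ?thesis using G by (simp add: ennreal_mult[symmetric] power_mult ac_simps)
  qed
  have outer: "(\<integral>\<^sup>+x. ?F t x \<partial>lborel) = ennreal ((c * pi) powr (?n / 2) * (c / 4) ^ k * ?C)
      * ennreal (indicator {0..} t * (t powr ((p - ?n / 2 - k) - 1) * exp (- 1 * t)))" if "t \<noteq> 0" for t
  proof (cases "t > 0")
    case True
    then have tc: "t / c > 0" using c by simp
    have "(\<integral>\<^sup>+x. ?F t x \<partial>lborel) = (\<integral>\<^sup>+x. ennreal (t powr (p - 1) * exp (- t)) *
        ennreal (((x::real^'n) $ i) ^ (2 * k) * exp (- (t / c) * (x \<bullet> x))) \<partial>lborel)"
      using True by (intro nn_integral_cong) (simp add: ennreal_mult[symmetric] power_mult)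
    also have "\<dots> = ennreal (t powr (p - 1) * exp (- t)) *
        ennreal ((pi / (t / c)) powr (?n / 2) * (fact (2 * k) / ((4 * (t / c)) ^ k * fact k)))"
      by (subst nn_integral_cmult) (measurable, simp only: nn_integral_gaussian_moment_vec[OF tc])
    also have "\<dots> = ennreal ((t powr (p - 1) * exp (- t)) * ((pi / (t / c)) powr (?n / 2) * (fact (2 * k) / ((4 * (t / c)) ^ k * fact k))))"
      using tc True by (simp add: ennreal_mult[symmetric])
    also have "(t powr (p - 1) * exp (- t)) * ((pi / (t / c)) powr (?n / 2) * (fact (2 * k) / ((4 * (t / c)) ^ k * fact k)))
      = (c * pi) powr (?n / 2) * (c / 4) ^ k * ?C * (t powr ((p - ?n / 2 - k) - 1) * exp (- t))"
    proof -
      have "t powr ((p - ?n / 2 - k) - 1) = t powr (p - 1) / t powr (?n / 2) / t ^ k"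
        using True by (simp add: powr_diff[symmetric] powr_realpow[symmetric] algebra_simps)
      moreover have "(pi / (t / c)) powr (?n / 2) = (c * pi) powr (?n / 2) / t powr (?n / 2)"
        using True c by (simp add: powr_divide[symmetric] mult.commute)
      moreover have "(4 * (t / c)) ^ k = t ^ k / (c / 4) ^ k"
        using True c by (simp add: power_divide[symmetric] mult.commute)
      moreover have "x * y * (a / b * (fact (2 * k) / (z / w * fact k))) = a * w * ?C * (x / b / z * y)"
        for x y a b z w :: real
        by (simp add: field_simps)
      ultimately show ?thesis by simp
    qed
    finally show ?thesis using True c by (simp add: ennreal_mult[symmetric])
  next
    case False
    then show ?thesis using that by (simp add: indicator_def)
  qed
  \<comment> \<open>The Gaussian formula needs a positive rate; the point t = 0 is a null set, so
    \<open>outer\<close> suffices almost everywhere.\<close>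
  have AE0: "AE t in lborel. t \<noteq> (0::real)" by (rule AE_lborel_singleton)
  have p': "p - ?n / 2 - k > 0" using p by simp
  have "ennreal (Gamma p) * (\<integral>\<^sup>+x. ennreal ((x $ i) ^ (2 * k) * (1 + (x \<bullet> x) / c) powr (- p)) \<partial>(lborel :: (real^'n) measure))
      = (\<integral>\<^sup>+x. (\<integral>\<^sup>+t. ?F t x \<partial>lborel) \<partial>lborel)"
    unfolding inner by (subst nn_integral_cmult) auto
  also have "\<dots> = (\<integral>\<^sup>+t. (\<integral>\<^sup>+x. ?F t x \<partial>lborel) \<partial>lborel)"
    by (rule lborel_pair.Fubini'[symmetric]) measurable
  also have "\<dots> = (\<integral>\<^sup>+t. ennreal ((c * pi) powr (?n / 2) * (c / 4) ^ k * ?C)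
      * ennreal (indicator {0..} t * (t powr ((p - ?n / 2 - k) - 1) * exp (- 1 * t))) \<partial>lborel)"
    by (intro nn_integral_cong_AE eventually_mono[OF AE0] outer)
  also have "\<dots> = ennreal ((c * pi) powr (?n / 2) * (c / 4) ^ k * ?C) * ennreal (Gamma (p - ?n / 2 - k))"
    by (subst nn_integral_cmult) (use nn_integral_Gamma_scale[OF p', of 1] in auto)
  also have "\<dots> = ennreal (Gamma p) * ennreal ((c * pi) powr (?n / 2) * (c / 4) ^ k * ?C
        * Gamma (p - ?n / 2 - k) / Gamma p)"
    using G c Gamma_real_pos[OF p'] by (simp add: ennreal_mult[symmetric])
  finally show ?thesis
    using G by (simp add: ennreal_mult_cancel_left)
qed

subsection \<open>The Student-t distribution\<close>

lemma student_t_density_measurable [measurable]: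
  "student_t_density nu \<mu> R \<in> borel_measurable borel"
proof -
  have "(\<lambda>v. (v - \<mu>) \<bullet> (matrix_inv R *v (v - \<mu>))) \<in> borel_measurable borel"
    unfolding matrix_vector_mult_diff_distrib by measurable
  then show ?thesis unfolding student_t_density_def by measurable
qed

lemma sets_student_t [measurable_cong, simp]: "sets (student_t nu \<mu> R) = sets borel"
  by (simp add: student_t_def)

lemma space_student_t [simp]: "space (student_t nu \<mu> R) = UNIV"
  by (simp add: student_t_def)

section \<open>The standard law and its affine images\<close>

lemma student_t_density_standard:
  fixes nu :: real and x :: "real^'n"
  shows
  "student_t_density nu 0 (mat 1 :: real^'n^'n) x
     = Gamma ((nu + CARD('n)) / 2) / (Gamma (nu / 2) * ((nu - 2) * pi) powr (CARD('n) / 2))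
       * (1 + (x \<bullet> x) / (nu - 2)) powr (- ((nu + CARD('n)) / 2))"
proof -
  have "matrix_inv (mat 1 :: real^'n^'n) = mat 1" by (rule matrix_inv_unique) simp
  then show ?thesis by (simp add: student_t_density_def)
qed

text \<open>The case k = 0 is the normalization of the density and k = 1 the unit second moment of
  each coordinate; one computation serves both.\<close>

lemma nn_integral_student_t_standard:
  fixes i :: "'n::finite"
  assumes nu: "nu > 2" and k: "k \<le> (1::nat)"
  shows "(\<integral>\<^sup>+x. ennreal ((x $ i) ^ (2 * k)) \<partial>student_t nu 0 (mat 1 :: real^'n^'n)) = 1"
proof -
  let ?n = "real CARD('n)"
  let ?p = "(nu + ?n) / 2"
  let ?c = "Gamma ?p / (Gamma (nu / 2) * ((nu - 2) * pi) powr (?n / 2))"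
  have G: "Gamma ?p > 0" "Gamma (nu / 2) > 0" using nu by (auto intro!: Gamma_real_pos add_pos_nonneg)
  have c: "?c \<ge> 0" using G by simp
  have p: "?p > ?n / 2 + k" using nu k by (simp add: field_simps)
  \<comment> \<open>For k = 1 the factor is (nu - 2) / 4 times 2, that is nu / 2 - 1, which is
    exactly what the recurrence of Gamma needs.\<close>
  have K: "((nu - 2) / 4) ^ k * (fact (2 * k) / fact k) * Gamma (nu / 2 - k) = Gamma (nu / 2)"
  proof (cases "k = 0")
    case False
    then have "k = 1" using k by simp
    moreover have "Gamma (nu / 2 - 1 + 1) = (nu / 2 - 1) * Gamma (nu / 2 - 1)"
      using nu by (intro Gamma_plus1) auto
    ultimately show ?thesis by (simp add: field_simps)
  qed simp
  have d: "ennreal (student_t_density nu 0 (mat 1) x) * ennreal ((x $ i) ^ (2 * k))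
     = ennreal ?c * ennreal ((x $ i) ^ (2 * k) * (1 + (x \<bullet> x) / (nu - 2)) powr (- ?p))" for x :: "real^'n"
  proof -
    have "(x $ i) ^ (2 * k) \<ge> 0" by (simp add: power_mult)
    then show ?thesis using c unfolding student_t_density_standard
      by (simp only: ennreal_mult[symmetric] mult_nonneg_nonneg powr_ge_zero mult_ac)
  qed
  have "(\<integral>\<^sup>+x. ennreal ((x $ i) ^ (2 * k)) \<partial>student_t nu 0 (mat 1 :: real^'n^'n))
     = (\<integral>\<^sup>+x. ennreal ?c * ennreal ((x $ i) ^ (2 * k) * (1 + (x \<bullet> x) / (nu - 2)) powr (- ?p)) \<partial>(lborel :: (real^'n) measure))"
    unfolding student_t_def by (subst nn_integral_density) (simp_all add: d)
  also have "\<dots> = ennreal ?c * (\<integral>\<^sup>+x. ennreal ((x $ i) ^ (2 * k) * (1 + (x \<bullet> x) / (nu - 2)) powr (- ?p)) \<partial>(lborel :: (real^'n) measure))"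
    by (rule nn_integral_cmult) measurable
  also have "\<dots> = ennreal ?c * ennreal (((nu - 2) * pi) powr (?n / 2) * ((nu - 2) / 4) ^ k * (fact (2 * k) / fact k)
        * Gamma (?p - ?n / 2 - k) / Gamma ?p)"
    using nu p by (subst nn_integral_student_t_moment) auto
  also have "?p - ?n / 2 - k = nu / 2 - k" by (simp add: field_simps)
  also have "((nu - 2) * pi) powr (?n / 2) * ((nu - 2) / 4) ^ k * (fact (2 * k) / fact k) * Gamma (nu / 2 - k) / Gamma ?p
     = ((nu - 2) * pi) powr (?n / 2) * Gamma (nu / 2) / Gamma ?p"
    by (simp only: K[symmetric] mult.assoc)
  also have "ennreal ?c * ennreal \<dots> = ennreal (?c * (((nu - 2) * pi) powr (?n / 2) * Gamma (nu / 2) / Gamma ?p))"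
    using G c by (intro ennreal_mult[symmetric]) auto
  also have "?c * (((nu - 2) * pi) powr (?n / 2) * Gamma (nu / 2) / Gamma ?p) = 1"
    using less_imp_neq[OF G(1)] less_imp_neq[OF G(2)] nu by (simp del: Gamma_real_pos)
  finally show ?thesis by simp
qed

text \<open>At the point m + B x the quadratic form of the general density reduces to that of the
  standard one at x, and the Jacobian of the map cancels the power of the determinant.\<close>

lemma student_t_affine:
  fixes B :: "real^'n^'n" and m :: "real^'n"
  assumes B: "invertible B"
  shows "student_t nu m (B ** transpose B) = distr (student_t nu 0 (mat 1)) borel (\<lambda>x. m + B *v x)"
proof -
  let ?T = "\<lambda>x. m + B *v x"
  let ?f = "student_t_density nu m (B ** transpose B)"
  have inv: "matrix_inv B ** B = mat 1" "B ** matrix_inv B = mat 1"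
    using B by (simp_all add: matrix_inv_left matrix_inv_right)
  \<comment> \<open>Regrouping brings together the two transposed factors, which collapse to the
    transpose of the identity.\<close>
  have "B ** transpose B ** (transpose (matrix_inv B) ** matrix_inv B)
      = B ** transpose (matrix_inv B ** B) ** matrix_inv B"
    by (simp add: matrix_transpose_mul matrix_mul_assoc)
  then have mi: "matrix_inv (B ** transpose B) = transpose (matrix_inv B) ** matrix_inv B"
    by (intro matrix_inv_unique) (simp add: inv transpose_mat)
  have quad: "(B *v x) \<bullet> (matrix_inv (B ** transpose B) *v (B *v x)) = x \<bullet> x" for x
  proof -
    have "(B *v x) \<bullet> (matrix_inv (B ** transpose B) *v (B *v x))
        = (B *v x) \<bullet> (transpose (matrix_inv B) *v x)"
      by (simp add: mi matrix_vector_mul_assoc matrix_mul_assoc[symmetric] inv)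
    also have "\<dots> = (matrix_inv B *v (B *v x)) \<bullet> x"
      by (metis dot_lmul_matrix vector_transpose_matrix transpose_transpose)
    finally show ?thesis by (simp add: matrix_vector_mul_assoc inv)
  qed
  have d0: "det B \<noteq> 0" using B by (simp add: invertible_det_nz)
  then have "(det B * det B) powr (- (1 / 2)) = 1 / \<bar>det B\<bar>"
    by (simp add: powr_minus powr_half_sqrt real_sqrt_abs2 inverse_eq_divide)
  then have f: "\<bar>det B\<bar> * ?f (?T x) = student_t_density nu 0 (mat 1) x" for x
    unfolding student_t_density_standard using d0
    by (simp add: student_t_density_def quad det_mul)
  have "student_t nu m (B ** transpose B)
      = density (density (distr lborel borel ?T) (\<lambda>_. ennreal \<bar>det B\<bar>)) (\<lambda>v. ennreal (?f v))"
    unfolding student_t_def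
    by (rule arg_cong[where f = "\<lambda>M. density M (\<lambda>v. ennreal (?f v))"]) (rule lborel_affine_matrix[OF B])
  also have "\<dots> = density (distr lborel borel ?T) (\<lambda>v. ennreal \<bar>det B\<bar> * ennreal (?f v))"
    by (rule density_density_eq) auto
  also have "\<dots> = distr (density lborel (\<lambda>x. ennreal \<bar>det B\<bar> * ennreal (?f (?T x)))) borel ?T"
    by (rule density_distr) auto
  also have "\<dots> = distr (student_t nu 0 (mat 1)) borel ?T"
    by (simp add: ennreal_mult'[symmetric] f student_t_def)
  finally show ?thesis .
qed

section \<open>Mean and covariance of the standard law\<close>

lemma prob_space_student_t_standard:
  assumes "nu > 2"
  shows "prob_space (student_t nu 0 (mat 1 :: real^'n^'n))"
  using nn_integral_student_t_standard[OF assms, of 0] by (intro prob_spaceI) simp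

lemma student_t_standard_square:
  fixes i :: "'n::finite"
  assumes "nu > 2"
  shows "has_bochner_integral (student_t nu 0 (mat 1 :: real^'n^'n)) (\<lambda>x. (x $ i)\<^sup>2) 1"
proof (rule has_bochner_integral_nn_integral)
  show "(\<integral>\<^sup>+x. ennreal ((x $ i)\<^sup>2) \<partial>student_t nu 0 (mat 1 :: real^'n^'n)) = ennreal 1"
    using nn_integral_student_t_standard[OF assms, of 1 i] by simp
  show "(\<lambda>x. (x $ i)\<^sup>2) \<in> borel_measurable (student_t nu 0 (mat 1 :: real^'n^'n))" by measurable
qed simp_all

text \<open>A reflection is an affine map whose matrix D is orthogonal, so D times its transpose is
  the identity and the affine image has the same parameters.\<close>

lemma student_t_standard_reflect:
  fixes i :: "'n::finite"
  shows "student_t nu 0 (mat 1 :: real^'n^'n)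
    = distr (student_t nu 0 (mat 1)) borel (\<lambda>x. \<chi> k. if k = i then - x $ k else x $ k)"
proof -
  define D :: "real^'n^'n" where "D = (\<chi> k l. if k = l then if k = i then - 1 else 1 else 0)"
  have "D ** transpose D = mat 1"
    by (simp add: D_def vec_eq_iff matrix_matrix_mult_def transpose_def mat_def if_distrib[of "\<lambda>a. a * _"] cong: if_cong)
  moreover from this have "invertible D" by (metis invertible_right_inverse)
  moreover have "D *v x = (\<chi> k. if k = i then - x $ k else x $ k)" for x
    by (simp add: D_def vec_eq_iff matrix_vector_mult_def if_distrib[of "\<lambda>a. a * _"] cong: if_cong)
  ultimately show ?thesis using student_t_affine[of D nu 0] by simp
qed

text \<open>Invariance under the reflection makes the integral equal to its own negative.
  Integrability is a separate matter, settled where the lemma is applied.\<close>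

lemma student_t_standard_odd:
  fixes i :: "'n::finite" and f :: "real^'n \<Rightarrow> real"
  assumes f[measurable]: "f \<in> borel_measurable borel"
    and odd: "\<And>x. f (\<chi> k. if k = i then - x $ k else x $ k) = - f x"
  shows "integral\<^sup>L (student_t nu 0 (mat 1)) f = 0"
proof -
  have [measurable]: "(\<lambda>x::real^'n. \<chi> k. if k = i then - x $ k else x $ k) \<in> borel_measurable borel"
  proof (intro borel_measurable_continuous_onI continuous_on_vec_lambda)
    fix k
    show "continuous_on UNIV (\<lambda>x::real^'n. if k = i then - x $ k else x $ k)"
      by (cases "k = i") (auto intro!: continuous_intros)
  qed
  have "integral\<^sup>L (student_t nu 0 (mat 1)) f = (\<integral>x. - f x \<partial>student_t nu 0 (mat 1))"
    by (subst student_t_standard_reflect[of nu i], subst integral_distr) (auto simp: odd)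
  then show ?thesis by simp
qed

lemma student_t_standard_mean:
  fixes i :: "'n::finite"
  assumes nu: "nu > 2"
  shows "has_bochner_integral (student_t nu 0 (mat 1 :: real^'n^'n)) (\<lambda>x. x $ i) 0"
proof -
  interpret prob_space "student_t nu 0 (mat 1 :: real^'n^'n)"
    using nu by (rule prob_space_student_t_standard)
  \<comment> \<open>On a probability space the constant 1 is integrable, so this bound makes
    \<open>x $ i\<close> integrable from its second moment.\<close>
  have bound: "\<bar>a\<bar> \<le> 1 + a\<^sup>2" for a :: real
    by (cases "\<bar>a\<bar> \<le> 1") (use self_le_power[of "\<bar>a\<bar>" 2] in \<open>auto intro: add_increasing2 add_increasing\<close>)
  have "integrable (student_t nu 0 (mat 1 :: real^'n^'n)) (\<lambda>x. x $ i)"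
  proof (rule Bochner_Integration.integrable_bound)
    show "integrable (student_t nu 0 (mat 1 :: real^'n^'n)) (\<lambda>x. 1 + (x $ i)\<^sup>2)"
      by (intro Bochner_Integration.integrable_add integrable_const
            integrable.intros[OF student_t_standard_square[OF nu]])
    show "(\<lambda>x. x $ i) \<in> borel_measurable (student_t nu 0 (mat 1 :: real^'n^'n))" by measurable
    show "AE x in student_t nu 0 (mat 1 :: real^'n^'n). norm (x $ i) \<le> norm (1 + (x $ i)\<^sup>2)"
      using bound by (intro AE_I2) (metis abs_ge_self order_trans real_norm_def)
  qed
  moreover have "integral\<^sup>L (student_t nu 0 (mat 1 :: real^'n^'n)) (\<lambda>x. x $ i) = 0"
    by (rule student_t_standard_odd[where i = i]) auto
  ultimately show ?thesis by (simp add: has_bochner_integral_iff)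
qed

lemma student_t_standard_covariance:
  fixes i j :: "'n::finite"
  assumes nu: "nu > 2"
  shows "has_bochner_integral (student_t nu 0 (mat 1 :: real^'n^'n)) (\<lambda>x. x $ i * x $ j) (if i = j then 1 else 0)"
proof (cases "i = j")
  case True
  then show ?thesis using student_t_standard_square[OF nu, of i] by (simp add: power2_eq_square)
next
  case False
  have bound: "\<bar>a * b\<bar> \<le> a\<^sup>2 + b\<^sup>2" for a b :: real
  proof -
    have "2 * (\<bar>a\<bar> * \<bar>b\<bar>) \<le> a\<^sup>2 + b\<^sup>2"
      using sum_squares_bound[of "\<bar>a\<bar>" "\<bar>b\<bar>"] by (simp add: mult.assoc)
    moreover have "0 \<le> \<bar>a\<bar> * \<bar>b\<bar>" by simp
    ultimately show ?thesis unfolding abs_mult by linarith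
  qed
  have "integrable (student_t nu 0 (mat 1 :: real^'n^'n)) (\<lambda>x. x $ i * x $ j)"
  proof (rule Bochner_Integration.integrable_bound)
    show "integrable (student_t nu 0 (mat 1 :: real^'n^'n)) (\<lambda>x. (x $ i)\<^sup>2 + (x $ j)\<^sup>2)"
      by (intro Bochner_Integration.integrable_add
            integrable.intros[OF student_t_standard_square[OF nu]])
    show "(\<lambda>x. x $ i * x $ j) \<in> borel_measurable (student_t nu 0 (mat 1 :: real^'n^'n))" by measurable
    show "AE x in student_t nu 0 (mat 1 :: real^'n^'n). norm (x $ i * x $ j) \<le> norm ((x $ i)\<^sup>2 + (x $ j)\<^sup>2)"
      using bound by (intro AE_I2) (metis abs_ge_self order_trans real_norm_def)
  qed
  \<comment> \<open>Reflecting coordinate i alone changes the sign of the product, since j differs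
    from i.\<close>
  moreover have "integral\<^sup>L (student_t nu 0 (mat 1 :: real^'n^'n)) (\<lambda>x. x $ i * x $ j) = 0"
    using False by (intro student_t_standard_odd[where i = i]) auto
  ultimately show ?thesis using False by (simp add: has_bochner_integral_iff)
qed

section \<open>Moments for general parameters\<close>

lemma prob_space_student_t:
  fixes S :: "real^'n^'n"
  assumes "nu > 2" "sym_pos_def S"
  shows "prob_space (student_t nu m S)"
proof -
  obtain B :: "real^'n^'n" where B: "B ** transpose B = S" "invertible B"
    using assms(2) by (rule sym_pos_def_factorization)
  show ?thesis unfolding B(1)[symmetric] student_t_affine[OF B(2)]
    by (intro prob_space.prob_space_distr prob_space_student_t_standard assms) simp
qed

lemma student_t_second_moment:
  fixes S :: "real^'n^'n" and m :: "real^'n"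
  assumes nu: "nu > 2" and S: "sym_pos_def S"
  shows "has_bochner_integral (student_t nu m S) (\<lambda>u. u $ i * u $ j) (S $ i $ j + m $ i * m $ j)"
proof -
  obtain B :: "real^'n^'n" where B: "B ** transpose B = S" "invertible B"
    using S by (rule sym_pos_def_factorization)
  let ?T = "student_t nu 0 (mat 1 :: real^'n^'n)"
  interpret prob_space ?T using nu by (rule prob_space_student_t_standard)
  have const: "has_bochner_integral ?T (\<lambda>_. m $ i * m $ j) (m $ i * m $ j)"
    using prob_space by (simp add: has_bochner_integral_iff)
  \<comment> \<open>Termwise expansion of the product of the i-th and j-th entries of m + B x: both
    linear sums have mean 0, and the double sum keeps only its diagonal.\<close>
  have "has_bochner_integral ?T
     (\<lambda>x. m $ i * m $ j + (\<Sum>l\<in>UNIV. (m $ i * B $ j $ l) * x $ l) + (\<Sum>k\<in>UNIV. (m $ j * B $ i $ k) * x $ k)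
        + (\<Sum>k\<in>UNIV. \<Sum>l\<in>UNIV. (B $ i $ k * B $ j $ l) * (x $ k * x $ l)))
     (m $ i * m $ j + (\<Sum>l\<in>UNIV. (m $ i * B $ j $ l) * 0) + (\<Sum>k\<in>UNIV. (m $ j * B $ i $ k) * 0)
        + (\<Sum>k\<in>UNIV. \<Sum>l\<in>UNIV. (B $ i $ k * B $ j $ l) * (if k = l then 1 else 0)))"
    by (intro has_bochner_integral_add const has_bochner_integral_sum has_bochner_integral_mult_right
          student_t_standard_mean[OF nu] student_t_standard_covariance[OF nu])
  moreover have "(\<Sum>k\<in>UNIV. \<Sum>l\<in>UNIV. (B $ i $ k * B $ j $ l) * (if k = l then 1 else 0)) = S $ i $ j"
    by (simp add: B(1)[symmetric] matrix_matrix_mult_def transpose_def if_distrib[of "\<lambda>a. _ * a"] cong: if_cong)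
  moreover have "m $ i * m $ j + (\<Sum>l\<in>UNIV. (m $ i * B $ j $ l) * x $ l) + (\<Sum>k\<in>UNIV. (m $ j * B $ i $ k) * x $ k)
        + (\<Sum>k\<in>UNIV. \<Sum>l\<in>UNIV. (B $ i $ k * B $ j $ l) * (x $ k * x $ l))
      = (m + B *v x) $ i * (m + B *v x) $ j" for x
    by (simp add: matrix_vector_mult_def algebra_simps sum_distrib_left sum_distrib_right)
       (subst sum.swap, simp add: mult_ac)
  ultimately have "has_bochner_integral ?T (\<lambda>x. (m + B *v x) $ i * (m + B *v x) $ j) (S $ i $ j + m $ i * m $ j)"
    by (simp add: add.commute)
  then show ?thesis
    unfolding B(1)[symmetric] student_t_affine[OF B(2)]
    by (subst has_bochner_integral_distr) auto
qed

lemma student_t_quadratic_form: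
  fixes S P :: "real^'n^'n" and m :: "real^'n"
  assumes nu: "nu > 2" and S: "sym_pos_def S"
  shows "has_bochner_integral (student_t nu m S) (\<lambda>u. u \<bullet> (P *v u))
           (trace (P ** S) + trace (P ** outer_product m m))"
proof -
  \<comment> \<open>The trace pairs the (i, j) entry of P with the (j, i) entry of S, whereas the
    expectation pairs it with the (i, j) entry.\<close>
  have Ss: "S $ i $ j = S $ j $ i" for i j
    using S unfolding sym_pos_def_def transpose_def vec_eq_iff by simp
  have "has_bochner_integral (student_t nu m S) (\<lambda>u. \<Sum>i\<in>UNIV. \<Sum>j\<in>UNIV. P $ i $ j * (u $ i * u $ j))
      (\<Sum>i\<in>UNIV. \<Sum>j\<in>UNIV. P $ i $ j * (S $ i $ j + m $ i * m $ j))"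
    by (intro has_bochner_integral_sum has_bochner_integral_mult_right student_t_second_moment[OF nu S])
  moreover have "(\<Sum>i\<in>UNIV. \<Sum>j\<in>UNIV. P $ i $ j * (u $ i * u $ j)) = u \<bullet> (P *v u)" for u
    by (simp add: inner_vec_def matrix_vector_mult_def sum_distrib_left mult_ac)
  moreover have "(\<Sum>i\<in>UNIV. \<Sum>j\<in>UNIV. P $ i $ j * (S $ i $ j + m $ i * m $ j))
      = trace (P ** S) + trace (P ** outer_product m m)"
    by (simp add: trace_def matrix_matrix_mult_def outer_product_def columnvector_def rowvector_def
          distrib_left sum.distrib Ss mult_ac)
  ultimately show ?thesis by simp
qed

text \<open>Integrability is part of the conclusion because the Bochner integral of a non-integrable
  function is 0 by convention; as the right-hand side is nonnegative, the inequality alone would not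
  exclude that degenerate reading.\<close>

theorem theoremA1:
  fixes nu nu' :: real
    and K S :: "real^'m^'m"
    and m :: "real^'m"
    and q :: "(real^'m) measure"
  assumes "nu > 2" and "nu' > 2"
    and "sym_pos_def K" and "sym_pos_def S"
    and "q = student_t nu' m S"
  shows "integrable q (log_quadratic nu K) \<and>
         L2 nu K q \<le> ln (1 + 1 / (nu - 2) * trace (matrix_inv K ** S)
                            + 1 / (nu - 2) * trace (matrix_inv K ** outer_product m m))"
proof -
  let ?P = "matrix_inv K"
  define Y where "Y u = 1 / (nu - 2) * (u \<bullet> (?P *v u))" for u
  define t where "t = 1 / (nu - 2) * trace (?P ** S) + 1 / (nu - 2) * trace (?P ** outer_product m m)"
  interpret prob_space q unfolding assms(5) by (rule prob_space_student_t) fact+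
  have "u \<bullet> (?P *v u) \<ge> 0" for u
    using sym_pos_def_matrix_inv[OF assms(3)] unfolding sym_pos_def_def
    by (cases "u = 0") (auto simp: less_imp_le)
  then have Y0: "Y u \<ge> 0" for u using assms(1) by (simp add: Y_def)
  have Y: "has_bochner_integral q Y t"
    unfolding Y_def t_def assms(5) distrib_left[symmetric]
    by (intro has_bochner_integral_mult_right student_t_quadratic_form assms(2,4))
  then have Yint: "integrable q Y" and EY: "integral\<^sup>L q Y = t"
    by (auto simp: has_bochner_integral_iff)
  \<comment> \<open>As the mean of a nonnegative function, \<open>t\<close> is nonnegative; the two
    traces need no separate discussion.\<close>
  then have t0: "t \<ge> 0" using Y0 unfolding EY[symmetric] by (intro Bochner_Integration.integral_nonneg)
  have lq: "log_quadratic nu K = (\<lambda>u. ln (1 + Y u))" by (simp add: log_quadratic_def Y_def fun_eq_iff)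
  have int: "integrable q (\<lambda>u. ln (1 + Y u))"
  proof (rule Bochner_Integration.integrable_bound[OF Yint])
    show "(\<lambda>u. ln (1 + Y u)) \<in> borel_measurable q" using Yint by measurable
    show "AE u in q. norm (ln (1 + Y u)) \<le> norm (Y u)"
      using Y0 by (auto simp: ln_add_one_self_le_self)
  qed
  \<comment> \<open>Jensen: the graph of \<open>ln\<close> lies below its tangent at the mean.\<close>
  have tangent: "ln (1 + Y u) \<le> ln (1 + t) + (Y u - t) / (1 + t)" for u
  proof -
    have "ln ((1 + Y u) / (1 + t)) \<le> (1 + Y u) / (1 + t) - 1"
      using Y0[of u] t0 by (intro ln_le_minus_one) auto
    also have "(1 + Y u) / (1 + t) - 1 = (Y u - t) / (1 + t)" using t0 by (simp add: field_simps)
    finally show ?thesis using Y0[of u] t0 by (simp add: ln_div)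
  qed
  \<comment> \<open>The linear term of the tangent integrates to 0, because \<open>Y\<close> has
    mean \<open>t\<close> and \<open>q\<close> has mass 1.\<close>
  have "(\<integral>u. ln (1 + Y u) \<partial>q) \<le> (\<integral>u. ln (1 + t) + (Y u - t) / (1 + t) \<partial>q)"
    using Yint by (intro integral_mono int tangent) auto
  also have "\<dots> = ln (1 + t)" using Yint by (simp add: EY prob_space)
  finally have "L2 nu K q \<le> ln (1 + t)" by (simp add: L2_def lq)
  then show ?thesis using int by (simp add: lq t_def add.assoc)
qed

end
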